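(* Let $\beta\ge 2$. Any adversary process $\mathcal{B}$ showing a lower bound of $c$ for the asymptotic competitive ratio of any online bin packing algorithm can be converted into a fully-dynamic bin packing instance with general movement costs such that any fully-dynamic bin packing algorithm with amortized recourse at most $\beta$ must have asymptotic competitive ratio at least $c$.
   Context: Online bin packing: items arrive one at a time and must be placed immediately and irrevocably into unit bins. An adversary process for online bin packing is an adaptive process that, depending on the current state of the system (the current set of bin configurations packing the current items), either adds a new item or stops; it shows a lower bound of $c$ for online algorithms if for every online algorithm, the process started from the empty system eventually reaches a state where the asymptotic competitive ratio is at least $c$. Fully-dynamic bin packing: items (size $s_i\in[0,1]$, movement cost $c_i\ge 0$, arbitrary under general movement costs) are inserted and deleted; at each time $t$ the algorithm maintains a packing of the current items $\mathcal{I}_t$ into unit bins, paying $c_i$ each time it moves item $i$. It has asymptotic competitive ratio $\alpha'$ (with additive term $\beta'$) if it always uses at most $\alpha'\cdot OPT(\mathcal{I}_t)+\beta'$ bins, and amortized recourse $\gamma$ if its total movement cost up to time $t$ is at most $\gamma\sum_{i=1}^t c_i$, $c_i$ being the cost of the item updated at time $i$. *)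

theory Defs
  imports "HOL-Analysis.Analysis" "HOL-Library.Multiset"
begin

definition opt_bins :: "real multiset \<Rightarrow> nat" where
  "opt_bins M = (LEAST k. \<exists>P :: real multiset list.
      length P = k \<and> sum_list P = M \<and> (\<forall>B\<in>set P. sum_mset B \<le> 1))"

text \<open>A deterministic online algorithm sees the sequence of item sizes so far (the last
  entry being the newly arrived item) and returns the (label of the) bin into which the new
  item is put irrevocably.  Bins are labelled by natural numbers.\<close>
type_synonym online_alg = "real list \<Rightarrow> nat"

definition ob_bin :: "online_alg \<Rightarrow> real list \<Rightarrow> nat \<Rightarrow> nat" where
  "ob_bin alg xs i = alg (take (Suc i) xs)"

definition ob_used_bins :: "online_alg \<Rightarrow> real list \<Rightarrow> nat set" where
  "ob_used_bins alg xs = ob_bin alg xs ` {..<length xs}"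

definition ob_num_bins :: "online_alg \<Rightarrow> real list \<Rightarrow> nat" where
  "ob_num_bins alg xs = card (ob_used_bins alg xs)"

definition ob_state :: "online_alg \<Rightarrow> real list \<Rightarrow> real multiset multiset" where
  "ob_state alg xs = image_mset
     (\<lambda>b. mset [xs ! i. i \<leftarrow> [0..<length xs], ob_bin alg xs i = b])
     (mset_set (ob_used_bins alg xs))"

definition valid_online :: "online_alg \<Rightarrow> bool" where
  "valid_online alg \<longleftrightarrow> (\<forall>xs. (\<forall>x\<in>set xs. 0 < x \<and> x \<le> 1) \<longrightarrow>
      (\<forall>b. (\<Sum>i\<in>{i. i < length xs \<and> ob_bin alg xs i = b}. xs ! i) \<le> 1))"

text \<open>An adversary process: depending on the current state, either adds an item of the given
  size (Some s) or stops (None).\<close>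
type_synonym adversary = "real multiset multiset \<Rightarrow> real option"

definition adversary_process :: "adversary \<Rightarrow> bool" where
  "adversary_process B \<longleftrightarrow> (\<forall>S s. B S = Some s \<longrightarrow> 0 < s \<and> s \<le> 1)"

fun adv_run :: "adversary \<Rightarrow> online_alg \<Rightarrow> nat \<Rightarrow> real list" where
  "adv_run B alg 0 = []"
| "adv_run B alg (Suc n) = (let xs = adv_run B alg n in
      (case B (ob_state alg xs) of None \<Rightarrow> xs | Some s \<Rightarrow> xs @ [s]))"

definition shows_lower_bound :: "adversary \<Rightarrow> real \<Rightarrow> bool" where
  "shows_lower_bound B c \<longleftrightarrow> (\<forall>alg. valid_online alg \<longrightarrow>
     (\<forall>a < c. \<forall>d. \<exists>n. real (ob_num_bins alg (adv_run B alg n))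
                        > a * real (opt_bins (mset (adv_run B alg n))) + d))"

text \<open>Ins i s c: insert item with identifier i, size s and movement cost c; Del i: delete i.\<close>
datatype upd = Ins nat real real | Del nat

fun items_step :: "nat set \<Rightarrow> upd \<Rightarrow> nat set" where
  "items_step A (Ins i s c) = insert i A"
| "items_step A (Del i) = A - {i}"

definition items :: "upd list \<Rightarrow> nat set" where
  "items us = foldl items_step {} us"

definition ids :: "upd list \<Rightarrow> nat set" where
  "ids us = {i. \<exists>s c. Ins i s c \<in> set us}"

fun sz :: "upd list \<Rightarrow> nat \<Rightarrow> real" where
  "sz [] i = 0"
| "sz (Ins j s c # us) i = (if i = j then s else sz us i)"
| "sz (Del j # us) i = sz us i"

fun cst :: "upd list \<Rightarrow> nat \<Rightarrow> real" where
  "cst [] i = 0"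
| "cst (Ins j s c # us) i = (if i = j then c else cst us i)"
| "cst (Del j # us) i = cst us i"

definition wf_upds :: "upd list \<Rightarrow> bool" where
  "wf_upds us \<longleftrightarrow> (\<forall>k < length us. (case us ! k of
      Ins i s c \<Rightarrow> 0 \<le> s \<and> s \<le> 1 \<and> 0 \<le> c \<and> i \<notin> ids (take k us)
    | Del i \<Rightarrow> i \<in> items (take k us)))"

definition upd_cost :: "upd list \<Rightarrow> nat \<Rightarrow> real" where
  "upd_cost us k = (case us ! k of Ins i s c \<Rightarrow> c | Del i \<Rightarrow> cst us i)"

text \<open>A deterministic fully-dynamic algorithm maps the sequence of updates so far to a packing
  (bin label of each current item) of the current items.\<close>
type_synonym fd_alg = "upd list \<Rightarrow> nat \<Rightarrow> nat"

definition valid_fd :: "fd_alg \<Rightarrow> bool" where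
  "valid_fd A \<longleftrightarrow> (\<forall>us. wf_upds us \<longrightarrow>
      (\<forall>b. (\<Sum>i\<in>{i\<in>items us. A us i = b}. sz us i) \<le> 1))"

definition move_cost :: "fd_alg \<Rightarrow> upd list \<Rightarrow> nat \<Rightarrow> real" where
  "move_cost A us t = (\<Sum>i\<in>{i \<in> items (take (t - 1) us) \<inter> items (take t us).
       A (take (t - 1) us) i \<noteq> A (take t us) i}. cst us i)"

definition amortized_recourse_le :: "fd_alg \<Rightarrow> real \<Rightarrow> bool" where
  "amortized_recourse_le A g \<longleftrightarrow> (\<forall>us. wf_upds us \<longrightarrow>
      (\<Sum>t\<in>{1..length us}. move_cost A us t) \<le> g * (\<Sum>k<length us. upd_cost us k))"

definition fd_num_bins :: "fd_alg \<Rightarrow> upd list \<Rightarrow> nat" where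
  "fd_num_bins A us = card (A us ` items us)"

definition fd_opt :: "upd list \<Rightarrow> nat" where
  "fd_opt us = opt_bins (image_mset (sz us) (mset_set (items us)))"

text \<open>An adaptive fully-dynamic instance: the next update is chosen from the updates so far
  and the history of packings maintained by the algorithm (packings after 0,1,...,t updates).\<close>
type_synonym fd_adversary = "upd list \<Rightarrow> (nat \<Rightarrow> nat) list \<Rightarrow> upd"

fun fd_play :: "fd_adversary \<Rightarrow> fd_alg \<Rightarrow> nat \<Rightarrow> upd list" where
  "fd_play F A 0 = []"
| "fd_play F A (Suc n) = (let us = fd_play F A n in
      us @ [F us (map (\<lambda>k. A (take k us)) [0..<Suc (length us)])])"

end

theory Submission
  imports Defs
begin

text \<open>
  The item inserted at time \<open>i\<close> gets movement cost \<open>2 ^ (- i)\<close>. All insertions and deletions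
  together then cost at most 4, so bounded amortized recourse lets every item move only finitely
  often. The dynamic adversary treats the current items as a stack: the next item is the one
  requested by the online adversary on the current packing, unless some item has moved away from
  the bin on which the request for a later item was based; in that case the youngest item is
  deleted. Infinitely many items are never deleted. When such an item \<open>i\<close> arrives, the current
  items are exactly the never deleted ones older than \<open>i\<close>, and they lie in the bins in which they
  finally settle. Placing the never deleted items irrevocably into these bins is therefore the
  behaviour of an online algorithm against the online adversary, and each of its states is a
  state of the dynamic game.
\<close>

section \<open>Packings as multisets of bins\<close>

text \<open>The index type is left open so that online packings, indexed by arrival position, and
  dynamic packings, indexed by insertion time, can be compared directly.\<close>

definition packing_state :: "('a \<Rightarrow> real) \<Rightarrow> ('a \<Rightarrow> nat) \<Rightarrow> 'a set \<Rightarrow> real multiset multiset" where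
  "packing_state s p I =
     image_mset (\<lambda>b. image_mset s (mset_set {i \<in> I. p i = b})) (mset_set (p ` I))"

lemma packing_state_cong:
  assumes "\<And>i. i \<in> I \<Longrightarrow> s i = s' i" and "\<And>i. i \<in> I \<Longrightarrow> p i = p' i"
  shows "packing_state s p I = packing_state s' p' I"
proof -
  have "p ` I = p' ` I" and "\<And>b. {i \<in> I. p i = b} = {i \<in> I. p' i = b}"
    using assms(2) by auto
  moreover have "image_mset s (mset_set {i \<in> I. p' i = b}) = image_mset s' (mset_set {i \<in> I. p' i = b})"
    for b
    by (rule image_mset_cong) (metis (no_types, lifting) assms(1) elem_mset_set
        mem_Collect_eq mset_set.infinite empty_iff set_mset_empty)
  ultimately show ?thesis
    unfolding packing_state_def by simp
qed

lemma packing_state_image: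
  assumes "inj_on e K"
  shows "packing_state s p (e ` K) = packing_state (s \<circ> e) (p \<circ> e) K"
proof -
  have "image_mset s (mset_set {i \<in> e ` K. p i = b}) = image_mset (s \<circ> e) (mset_set {k \<in> K. (p \<circ> e) k = b})"
    for b
  proof -
    have eq: "{i \<in> e ` K. p i = b} = e ` {k \<in> K. (p \<circ> e) k = b}"
      by auto
    have "inj_on e {k \<in> K. (p \<circ> e) k = b}"
      using assms by (rule inj_on_subset) auto
    then have "mset_set {i \<in> e ` K. p i = b} = image_mset e (mset_set {k \<in> K. (p \<circ> e) k = b})"
      unfolding eq by (simp add: image_mset_mset_set)
    then show ?thesis
      by (simp add: image_mset.compositionality)
  qed
  then show ?thesis
    unfolding packing_state_def by (simp add: image_comp)
qed

text \<open>The adversary cannot see bin labels, so an online algorithm may double the labels it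
  copies and keep the odd ones free.\<close>

lemma packing_state_relabel:
  assumes "inj r"
  shows "packing_state s (r \<circ> p) I = packing_state s p I"
proof -
  have "mset_set ((r \<circ> p) ` I) = image_mset r (mset_set (p ` I))"
    using assms by (simp add: image_comp image_mset_mset_set inj_on_subset)
  moreover have "{i \<in> I. (r \<circ> p) i = r b} = {i \<in> I. p i = b}" for b
    using assms by (auto dest: injD)
  ultimately show ?thesis
    unfolding packing_state_def by (simp add: image_mset.compositionality comp_def)
qed

section \<open>The online game along a prescribed packing\<close>

lemma mset_filter_upt:
  "mset [f i. i \<leftarrow> [0..<n], P i] = image_mset f (mset_set {i \<in> {..<n}. P i})"
proof -
  have "[f i. i \<leftarrow> [0..<n], P i] = map f (filter P [0..<n])"
    by (induction n) auto
  moreover have "mset (filter P [0..<n]) = mset_set {i \<in> {..<n}. P i}"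
    by (simp add: mset_filter filter_mset_mset_set atLeast0LessThan)
  ultimately show ?thesis
    by (simp only: mset_map)
qed

lemma ob_state_eq_packing_state:
  "ob_state alg xs = packing_state (\<lambda>i. xs ! i) (ob_bin alg xs) {..<length xs}"
  unfolding ob_state_def packing_state_def ob_used_bins_def mset_filter_upt ..

text \<open>The online algorithm copies the packing \<open>b\<close> with even labels as long as the input follows
  \<open>x\<close>, and puts every later item into a fresh bin with an odd label. If \<open>B\<close> stops, its run
  is still a prefix of \<open>x\<close>.\<close>
lemma shows_lower_bound_on_run:
  fixes x :: "nat \<Rightarrow> real" and b :: "nat \<Rightarrow> nat"
  assumes lb: "shows_lower_bound B c"
    and fits: "\<And>k v. (\<Sum>l\<in>{l \<in> {..<k}. b l = v}. x l) \<le> 1"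
    and follows: "\<And>k s. B (packing_state x b {..<k}) = Some s \<Longrightarrow> x k = s"
    and "a < c"
  shows "\<exists>k. real (card (b ` {..<k})) > a * real (opt_bins (image_mset x (mset_set {..<k}))) + d"
proof -
  define on_run where "on_run ys \<longleftrightarrow> ys = map x [0..<length ys]" for ys
  define alg where "alg ys = (if on_run ys then 2 * b (length ys - 1) else 2 * length ys + 1)" for ys
  have on_run_take: "on_run (take m ys)" if "on_run ys" for m ys
    using that unfolding on_run_def by (metis length_take take_map take_upt min.commute min_def
        add_0 take_all nle_le)
  have bin_run: "ob_bin alg (map x [0..<k]) l = 2 * b l" if "l < k" for k l
    using that by (simp add: ob_bin_def alg_def on_run_def take_map)
  have "valid_online alg"
    unfolding valid_online_def
  proof (intro allI impI)
    fix xs :: "real list" and v :: nat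
    assume bounds: "\<forall>y\<in>set xs. 0 < y \<and> y \<le> 1"
    let ?L = "{i. i < length xs \<and> ob_bin alg xs i = v}"
    show "(\<Sum>i\<in>?L. xs ! i) \<le> 1"
    proof (cases "even v")
      case True
      \<comment> \<open>Even labels are given only to prefixes that follow \<open>x\<close>, so
        every item of this bin comes from \<open>x\<close>.\<close>
      have on: "on_run (take (Suc i) xs)" "xs ! i = x i" "2 * b i = v" if "i \<in> ?L" for i
      proof -
        show r: "on_run (take (Suc i) xs)"
          using that True by (auto simp: ob_bin_def alg_def split: if_splits)
        have "take (Suc i) xs ! i = map x [0..<Suc i] ! i"
          using r that unfolding on_run_def by (simp del: upt_Suc)
        then show "xs ! i = x i"
          by (simp del: upt_Suc)
        show "2 * b i = v"
          using r that by (auto simp: ob_bin_def alg_def)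
      qed
      show ?thesis
      proof (cases "?L = {}")
        case False
        have fin: "finite ?L" by simp
        \<comment> \<open>The prefix ending with the last item of the bin follows \<open>x\<close>,
          hence so do all shorter ones. The bin is thus a bin of \<open>b\<close> restricted to
          \<open>{..<Suc m}\<close>, and \<open>fits\<close> applies.\<close>
        define m where "m = Max ?L"
        have "m \<in> ?L" using False fin unfolding m_def by (rule Max_in[rotated])
        have "?L = {l \<in> {..<Suc m}. b l = v div 2}"
        proof (intro set_eqI iffI)
          fix l assume "l \<in> ?L"
          then show "l \<in> {l \<in> {..<Suc m}. b l = v div 2}"
            using on(3)[of l] fin unfolding m_def by (simp add: less_Suc_eq_le)
        next
          fix l assume l: "l \<in> {l \<in> {..<Suc m}. b l = v div 2}"
          have "on_run (take (Suc l) (take (Suc m) xs))"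
            using on(1)[OF \<open>m \<in> ?L\<close>] by (rule on_run_take)
          then have "on_run (take (Suc l) xs)"
            using l by (simp add: min_def split: if_splits)
          then show "l \<in> ?L"
            using l \<open>m \<in> ?L\<close> True by (auto simp: ob_bin_def alg_def)
        qed
        moreover have "(\<Sum>i\<in>?L. xs ! i) = (\<Sum>i\<in>?L. x i)"
          using on(2) by (intro sum.cong) auto
        ultimately show ?thesis
          using fits by simp
      next
        case True
        then show ?thesis by (simp only: sum.empty)
      qed
    next
      case False
      \<comment> \<open>The prefix ending at position \<open>i\<close> has length
        \<open>Suc i\<close>, so an odd label determines \<open>i\<close> and its bin holds at most
        one item.\<close>
      have "2 * Suc i + 1 = v" if "i \<in> ?L" for i
        using that False by (auto simp: ob_bin_def alg_def split: if_splits)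
      then have "?L \<subseteq> {(v - 1) div 2 - 1}"
        by force
      then consider "?L = {}" | i where "?L = {i}"
        by blast
      then show ?thesis
      proof cases
        case 1
        then show ?thesis by (simp only: sum.empty)
      next
        case (2 i)
        then have "i < length xs" by auto
        then show ?thesis
          unfolding 2 using bounds by simp
      qed
    qed
  qed
  have state: "ob_state alg (map x [0..<k]) = packing_state x b {..<k}" for k
  proof -
    have "ob_state alg (map x [0..<k]) = packing_state x ((\<lambda>v. 2 * v) \<circ> b) {..<k}"
      unfolding ob_state_eq_packing_state length_map length_upt diff_zero
      by (rule packing_state_cong) (auto simp: bin_run)
    also have "\<dots> = packing_state x b {..<k}"
      by (rule packing_state_relabel) (auto intro: injI)
    finally show ?thesis .
  qed
  have run: "\<exists>k. adv_run B alg n = map x [0..<k]" for n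
  proof (induction n)
    case 0
    show ?case by (intro exI[of _ 0]) simp
  next
    case (Suc n)
    then obtain k where k: "adv_run B alg n = map x [0..<k]" by blast
    show ?case
    proof (cases "B (packing_state x b {..<k})")
      case None
      then show ?thesis by (intro exI[of _ k]) (simp add: k state)
    next
      case (Some s)
      then show ?thesis
        by (intro exI[of _ "Suc k"]) (simp add: k state follows)
    qed
  qed
  obtain n where n: "real (ob_num_bins alg (adv_run B alg n)) >
      a * real (opt_bins (mset (adv_run B alg n))) + d"
    using lb \<open>valid_online alg\<close> \<open>a < c\<close> unfolding shows_lower_bound_def by blast
  obtain k where k: "adv_run B alg n = map x [0..<k]"
    using run by blast
  have "ob_used_bins alg (map x [0..<k]) = (\<lambda>v. 2 * v) ` b ` {..<k}"
    by (auto simp: ob_used_bins_def bin_run image_iff)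
  then have "ob_num_bins alg (map x [0..<k]) = card (b ` {..<k})"
    unfolding ob_num_bins_def by (simp add: card_image inj_on_def)
  moreover have "mset (map x [0..<k]) = image_mset x (mset_set {..<k})"
    by (simp add: atLeast0LessThan)
  ultimately show ?thesis
    using n unfolding k by metis
qed

section \<open>Bookkeeping for update sequences\<close>

lemma items_snoc: "items (us @ [u]) = items_step (items us) u"
  by (simp add: items_def)

lemma ids_snoc:
  "ids (us @ [u]) = ids us \<union> (case u of Ins i s c \<Rightarrow> {i} | Del i \<Rightarrow> {})"
  by (cases u) (auto simp: ids_def)

lemma items_subset_ids: "items us \<subseteq> ids us"
proof (induction us rule: rev_induct)
  case Nil
  then show ?case by (simp add: items_def)
next
  case (snoc u us)
  then show ?case
    by (cases u) (auto simp: items_snoc ids_snoc)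
qed

lemma ids_Cons:
  "ids (u # us) = ids us \<union> (case u of Ins i s c \<Rightarrow> {i} | Del i \<Rightarrow> {})"
  by (cases u) (auto simp: ids_def)

text \<open>\<open>sz\<close> and \<open>cst\<close> read the first insertion of an identifier,
  which later updates do not affect.\<close>

lemma sz_cst_append:
  "i \<in> ids us \<Longrightarrow> sz (us @ vs) i = sz us i \<and> cst (us @ vs) i = cst us i"
proof (induction us)
  case Nil
  then show ?case by (simp add: ids_def)
next
  case (Cons u us)
  then show ?case by (cases u) (auto simp: ids_Cons)
qed

lemma sz_cst_snoc_Ins:
  "i \<notin> ids us \<Longrightarrow> sz (us @ [Ins i s c]) i = s \<and> cst (us @ [Ins i s c]) i = c"
proof (induction us)
  case (Cons u us)
  then show ?case by (cases u) (auto simp: ids_Cons)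
qed simp

section \<open>The dynamic game\<close>

text \<open>Items are identified by their insertion time, so \<open>hist ! i\<close> is the packing from which the
  size of item \<open>i\<close> was computed.\<close>
definition stack_adversary :: "adversary \<Rightarrow> fd_adversary" where
  "stack_adversary B us hist =
     (let I = items us; p = last hist in
      if \<forall>i\<in>I. \<forall>j\<in>I. j < i \<longrightarrow> (hist ! i) j = p j
      then Ins (length us) (case B (packing_state (sz us) p I) of None \<Rightarrow> 0 | Some s \<Rightarrow> s)
             ((1/2) ^ length us)
      else Del (Max I))"

locale stack_game =
  fixes B :: adversary and A :: fd_alg and \<beta> :: real
  assumes adversary: "adversary_process B"
    and valid: "valid_fd A"
    and recourse: "amortized_recourse_le A \<beta>"
begin

definition upds :: "nat \<Rightarrow> upd list" where
  "upds n = fd_play (stack_adversary B) A n"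

abbreviation cur :: "nat \<Rightarrow> nat set" where
  "cur n \<equiv> items (upds n)"

abbreviation packing :: "nat \<Rightarrow> nat \<Rightarrow> nat" where
  "packing n \<equiv> A (upds n)"

definition calm :: "nat \<Rightarrow> bool" where
  "calm n \<longleftrightarrow> (\<forall>i\<in>cur n. \<forall>j\<in>cur n. j < i \<longrightarrow> packing i j = packing n j)"

text \<open>After \<open>B\<close> stops, the game continues with items of size 0, which
  \<open>wf_upds\<close> admits. The comparison with the online run only constrains sizes that
  \<open>B\<close> requests.\<close>

definition next_size :: "nat \<Rightarrow> real" where
  "next_size n = (case B (packing_state (sz (upds n)) (packing n) (cur n)) of None \<Rightarrow> 0 | Some s \<Rightarrow> s)"

lemma length_upds [simp]: "length (upds n) = n"
  unfolding upds_def by (induction n) (auto simp: Let_def)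

lemma take_upds: "m \<le> n \<Longrightarrow> take m (upds n) = upds m"
proof (induction n)
  case (Suc n)
  have "upds (Suc n) = upds n @ [last (upds (Suc n))]"
    by (simp add: upds_def Let_def)
  then show ?case
    using Suc length_upds by (cases "m = Suc n") (metis take_all_iff order_refl, metis
        append_eq_conv_conj le_Suc_eq take_append diff_is_0_eq take_0 append_Nil2)
qed (simp add: upds_def)

definition next_upd :: "nat \<Rightarrow> upd" where
  "next_upd n = (if calm n then Ins n (next_size n) ((1/2) ^ n) else Del (Max (cur n)))"

text \<open>The two claims are linked: reading \<open>packing i\<close> off the history at position
  \<open>i\<close> requires \<open>i < n\<close>, which the bound on identifiers supplies.\<close>

lemma upds_Suc_and_ids: "upds (Suc n) = upds n @ [next_upd n] \<and> ids (upds n) \<subseteq> {..<n}"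
proof -
  have step: "upds (Suc n) = upds n @ [next_upd n]" if "ids (upds n) \<subseteq> {..<n}" for n
  proof -
    let ?hist = "map (\<lambda>k. A (take k (upds n))) [0..<Suc n]"
    have "last ?hist = packing n"
      by (simp add: take_upds)
    moreover have "?hist ! i = packing i" if "i \<in> cur n" for i
    proof -
      have "i < n"
        using that \<open>ids (upds n) \<subseteq> {..<n}\<close> items_subset_ids by blast
      then show ?thesis
        by (simp add: take_upds del: upt_Suc)
    qed
    ultimately have "stack_adversary B (upds n) ?hist = next_upd n"
      unfolding stack_adversary_def Let_def next_upd_def calm_def next_size_def by simp
    moreover have "upds (Suc n) = upds n @ [stack_adversary B (upds n) ?hist]"
      using length_upds[of n] by (simp add: upds_def Let_def)
    ultimately show ?thesis by simp
  qed
  have "ids (upds n) \<subseteq> {..<n}"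
  proof (induction n)
    case 0
    then show ?case by (simp add: upds_def ids_def)
  next
    case (Suc n)
    then show ?case
      by (auto simp: step ids_snoc next_upd_def)
  qed
  then show ?thesis using step by blast
qed

lemma upds_Suc: "upds (Suc n) = upds n @ [next_upd n]"
  and ids_upds: "ids (upds n) \<subseteq> {..<n}"
  using upds_Suc_and_ids by blast+

lemma nth_upds: "k < n \<Longrightarrow> upds n ! k = next_upd k"
proof -
  assume "k < n"
  then have "upds n ! k = take (Suc k) (upds n) ! k" by simp
  also have "\<dots> = next_upd k"
    using \<open>k < n\<close> by (simp add: take_upds upds_Suc nth_append)
  finally show ?thesis .
qed

lemma ids_mono: "m \<le> n \<Longrightarrow> ids (upds m) \<subseteq> ids (upds n)"
  unfolding ids_def by (auto simp: take_upds[symmetric, of m n] dest!: in_set_takeD)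

lemma cur_ids: "cur n \<subseteq> ids (upds n)"
  by (rule items_subset_ids)

lemma cur_less: "i \<in> cur n \<Longrightarrow> i < n"
  using cur_ids ids_upds by blast

lemma finite_cur [simp]: "finite (cur n)"
  using cur_less by (auto intro: finite_subset[of _ "{..<n}"])

lemma cur_0: "cur 0 = {}"
  by (simp add: upds_def items_def)

lemma cur_Suc: "cur (Suc n) = (if calm n then insert n (cur n) else cur n - {Max (cur n)})"
  by (simp add: upds_Suc items_snoc next_upd_def)

lemma not_calm_nonempty: "\<not> calm n \<Longrightarrow> cur n \<noteq> {}"
  by (auto simp: calm_def)

lemma Max_cur: "\<not> calm n \<Longrightarrow> Max (cur n) \<in> cur n"
  using not_calm_nonempty by simp

lemma sz_cst_upds: "i \<in> ids (upds n) \<Longrightarrow> sz (upds n) i = next_size i \<and> cst (upds n) i = (1/2) ^ i"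
proof (induction n)
  case 0
  then show ?case by (simp add: upds_def ids_def)
next
  case (Suc n)
  show ?case
  proof (cases "i \<in> ids (upds n)")
    case True
    then show ?thesis
      using Suc.IH by (simp add: upds_Suc sz_cst_append)
  next
    case False
    then have "calm n" "i = n"
      using Suc.prems by (auto simp: upds_Suc ids_snoc next_upd_def split: if_splits)
    then show ?thesis
      using False by (simp add: upds_Suc next_upd_def sz_cst_snoc_Ins)
  qed
qed

lemma sz_upds: "i \<in> cur n \<Longrightarrow> sz (upds n) i = next_size i"
  using sz_cst_upds cur_ids by blast

lemma wf_upds_upds: "wf_upds (upds n)"
  unfolding wf_upds_def
proof (intro allI impI)
  fix k assume "k < length (upds n)"
  then have "k < n" by simp
  have "0 \<le> next_size k \<and> next_size k \<le> 1"
    using adversary unfolding adversary_process_def next_size_def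
    by (fastforce split: option.splits)
  moreover have "k \<notin> ids (upds k)"
    using ids_upds by blast
  ultimately show "case upds n ! k of
      Ins i s c \<Rightarrow> 0 \<le> s \<and> s \<le> 1 \<and> 0 \<le> c \<and> i \<notin> ids (take k (upds n))
    | Del i \<Rightarrow> i \<in> items (take k (upds n))"
    using \<open>k < n\<close> Max_cur by (simp add: nth_upds take_upds next_upd_def)
qed

section \<open>Costs of the updates\<close>

lemma upd_cost_upds:
  assumes "k < n"
  shows "upd_cost (upds n) k = (if calm k then (1/2) ^ k else (1/2) ^ Max (cur k))"
proof -
  have "Max (cur k) \<in> ids (upds n)" if "\<not> calm k"
    using Max_cur[OF that] cur_ids ids_mono[of k n] assms by auto
  then show ?thesis
    using assms by (simp add: upd_cost_def nth_upds next_upd_def sz_cst_upds)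
qed

text \<open>Charging each current item's future deletion in advance makes a deletion free.\<close>
lemma total_upd_cost: "(\<Sum>k<n. upd_cost (upds n) k) \<le> 4"
proof -
  define w where "w k = (if calm k then (1/2) ^ k else (1/2) ^ Max (cur k) :: real)" for k
  \<comment> \<open>Each item is paid for at most twice, at insertion and at deletion, hence the
    factor 2; the geometric sum stays below 2.\<close>
  have "(\<Sum>k<n. w k) + (\<Sum>i\<in>cur n. (1/2) ^ i) \<le> 2 * (\<Sum>k<n. (1/2) ^ k)" for n
  proof (induction n)
    case 0
    then show ?case by (simp add: cur_0)
  next
    case (Suc n)
    show ?case
    proof (cases "calm n")
      case True
      moreover have "n \<notin> cur n" using cur_less by blast
      ultimately show ?thesis
        using Suc by (simp add: cur_Suc w_def)
    next
      case False
      then have "(\<Sum>i\<in>cur n. (1/2::real) ^ i) = (1/2) ^ Max (cur n) + (\<Sum>i\<in>cur (Suc n). (1/2) ^ i)"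
        using Max_cur by (simp add: cur_Suc sum.remove)
      then have "(\<Sum>k<Suc n. w k) + (\<Sum>i\<in>cur (Suc n). (1/2) ^ i) \<le> 2 * (\<Sum>k<n. (1/2) ^ k)"
        using Suc False by (simp add: w_def)
      also have "\<dots> \<le> 2 * (\<Sum>k<Suc n. (1/2) ^ k)"
        by simp
      finally show ?thesis .
    qed
  qed
  moreover have "(\<Sum>k<n. (1/2::real) ^ k) = 2 - 2 * (1/2) ^ n" for n :: nat
    by (induction n) auto
  moreover have "0 \<le> (\<Sum>i\<in>cur n. (1/2::real) ^ i)"
    by (intro sum_nonneg) simp
  moreover have "(\<Sum>k<n. upd_cost (upds n) k) = (\<Sum>k<n. w k)"
    by (intro sum.cong) (auto simp: upd_cost_upds w_def)
  moreover have "0 \<le> (1/2::real) ^ n" by simp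
  ultimately show ?thesis
    by (smt (verit, best))
qed

section \<open>Items that are never deleted\<close>

text \<open>Step \<open>m\<close> can insert only item \<open>m\<close>, so a deleted item never
  returns.\<close>

lemma cur_backwards:
  assumes "i \<in> cur n" and "i < m" and "m \<le> n"
  shows "i \<in> cur m"
  using \<open>m \<le> n\<close> \<open>i < m\<close>
proof (induction m rule: inc_induct)
  case base
  show ?case by fact
next
  case (step m)
  then have "i \<in> cur (Suc m)" by simp
  then show ?case
    using \<open>i < m\<close> by (auto simp: cur_Suc split: if_splits)
qed

text \<open>The bound is strict because item \<open>i\<close> is first present after update
  \<open>i\<close>, that is, in \<open>cur (Suc i)\<close>.\<close>

definition persistent :: "nat set" where
  "persistent = {i. \<forall>n>i. i \<in> cur n}"

lemma persistent_calm: "i \<in> persistent \<Longrightarrow> calm i"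
  unfolding persistent_def using cur_less[of i i] cur_Suc[of i] by (auto split: if_splits)

text \<open>Each such move costs \<open>(1/2) ^ j\<close>, while the recourse bound limits all
  movement costs together to 4 * |\<beta>|. The condition \<open>j < t\<close> makes
  \<open>j\<close> current both before and after the move.\<close>

lemma finite_moves:
  assumes "j \<in> persistent"
  shows "finite {t. j < t \<and> packing t j \<noteq> packing (Suc t) j}" (is "finite ?M")
proof (rule ccontr)
  assume inf: "infinite ?M"
  \<comment> \<open>One more than the budget 4 * |\<beta>| can pay for at \<open>(1/2) ^ j\<close>
    per move.\<close>
  define N where "N = nat \<lceil>\<bar>\<beta>\<bar> * 4 * 2 ^ j\<rceil> + 1"
  obtain X where X: "X \<subseteq> ?M" "finite X" "card X = N"
    using infinite_arbitrarily_large[OF inf] by blast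
  define n where "n = Suc (Max (insert 0 X))"
  have Xn: "Suc t \<in> {1..n}" if "t \<in> X" for t
    using X(2) that by (simp add: n_def)
  have cst_nonneg: "cst (upds n) i \<ge> 0" if "i \<in> cur m" "m \<le> n" for i m
    using sz_cst_upds[of i n] that cur_ids ids_mono by fastforce
  have move_nonneg: "move_cost A (upds n) t \<ge> 0" if "t \<in> {1..n}" for t
    unfolding move_cost_def using that
    by (intro sum_nonneg) (auto simp: take_upds intro: cst_nonneg)
  \<comment> \<open>\<open>move_cost\<close> at \<open>Suc t\<close> compares the packings after
    \<open>t\<close> and \<open>Suc t\<close> updates, hence the shift by one.\<close>
  have move_ge: "move_cost A (upds n) (Suc t) \<ge> (1/2) ^ j" if "t \<in> X" for t
  proof -
    have t: "j < t" "packing t j \<noteq> packing (Suc t) j" "Suc t \<le> n"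
      using X(1) Xn that by auto
    have j: "j \<in> cur m" if "m > j" for m
      using assms that by (auto simp: persistent_def)
    have "cst (upds n) j = (1/2) ^ j"
      using sz_cst_upds[of j n] j[of n] t cur_ids by fastforce
    moreover have "cst (upds n) j \<le> move_cost A (upds n) (Suc t)"
      unfolding move_cost_def
      by (rule member_le_sum) (use t j in \<open>auto simp: take_upds intro: cst_nonneg\<close>)
    ultimately show ?thesis by simp
  qed
  have "real N * (1/2) ^ j = (\<Sum>t\<in>X. (1/2) ^ j)"
    using X(3) by simp
  also have "\<dots> \<le> (\<Sum>t\<in>X. move_cost A (upds n) (Suc t))"
    by (intro sum_mono move_ge)
  also have "\<dots> = (\<Sum>t\<in>Suc ` X. move_cost A (upds n) t)"
    by (simp add: sum.reindex)
  also have "\<dots> \<le> (\<Sum>t\<in>{1..n}. move_cost A (upds n) t)"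
    using Xn by (intro sum_mono2 move_nonneg) auto
  also have "\<dots> \<le> \<beta> * (\<Sum>k<n. upd_cost (upds n) k)"
    using recourse wf_upds_upds[of n] unfolding amortized_recourse_le_def by fastforce
  also have "\<dots> \<le> \<bar>\<beta>\<bar> * (\<Sum>k<n. upd_cost (upds n) k)"
    by (intro mult_right_mono sum_nonneg) (auto simp: upd_cost_upds)
  also have "\<dots> \<le> \<bar>\<beta>\<bar> * 4"
    using total_upd_cost by (intro mult_left_mono) auto
  finally have "real N \<le> \<bar>\<beta>\<bar> * 4 * 2 ^ j"
    by (simp add: power_divide field_simps)
  moreover have "real N > \<bar>\<beta>\<bar> * 4 * 2 ^ j"
    unfolding N_def by linarith
  ultimately show False by linarith
qed

lemma eventually_fixed:
  assumes "j \<in> persistent"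
  obtains T where "\<And>n. n \<ge> T \<Longrightarrow> packing n j = packing T j"
proof -
  obtain T where T: "\<And>t. j < t \<Longrightarrow> packing t j \<noteq> packing (Suc t) j \<Longrightarrow> t < T"
    using finite_moves[OF assms] unfolding finite_nat_set_iff_bounded by blast
  define T' where "T' = max T (Suc j)"
  have "packing n j = packing T' j" if "n \<ge> T'" for n
    using that
  proof (induction n rule: dec_induct)
    case (step n)
    then show ?case
      using T[of n] unfolding T'_def by fastforce
  qed simp
  then show ?thesis by (rule that)
qed

text \<open>The items above \<open>cur n\<close> are younger and therefore deleted first.\<close>
lemma cur_subset_if_card_ge:
  assumes "\<And>m. m \<ge> n \<Longrightarrow> card (cur m) \<ge> card (cur n)" and "m \<ge> n"
  shows "cur n \<subseteq> cur m"
  using \<open>m \<ge> n\<close>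
proof (induction m rule: dec_induct)
  case (step m)
  show ?case
  proof (cases "calm m")
    case True
    then show ?thesis using step by (auto simp: cur_Suc)
  next
    case False
    \<comment> \<open>If the youngest item at time \<open>m\<close> were already in
      \<open>cur n\<close>, all of \<open>cur m\<close> would be, so the two sets would be equal and
      the deletion would push the cardinality below that of \<open>cur n\<close>.\<close>
    have "Max (cur m) \<notin> cur n"
    proof
      assume M: "Max (cur m) \<in> cur n"
      have "cur m \<subseteq> cur n"
      proof
        fix i assume "i \<in> cur m"
        then have "i < n"
          using M Max_ge[OF finite_cur, of i m] cur_less by (meson le_less_trans)
        then show "i \<in> cur n"
          using cur_backwards \<open>i \<in> cur m\<close> step.hyps by blast
      qed
      then have "card (cur (Suc m)) < card (cur n)"
        using step.IH False M Max_cur[OF False]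
        by (metis cur_Suc card_Diff1_less finite_cur subset_antisym)
      then show False
        using assms(1)[of "Suc m"] step.hyps by simp
    qed
    then show ?thesis using step False by (auto simp: cur_Suc)
  qed
qed simp

text \<open>Deletion takes the youngest item, so anything present when \<open>i\<close> arrives is
  protected for as long as \<open>i\<close> stays, here forever.\<close>

lemma cur_persistent:
  assumes "i \<in> persistent"
  shows "cur i = {j \<in> persistent. j < i}"
proof (intro set_eqI iffI)
  fix j assume j: "j \<in> cur i"
  have "j \<in> cur n" if "n > j" for n
  proof (cases "n \<ge> i")
    case True
    then show ?thesis
    proof (induction n rule: dec_induct)
      case (step n)
      show ?case
      proof (cases "calm n")
        case False
        then have "i \<in> cur (Suc n)"
          using assms step.hyps by (auto simp: persistent_def)
        then have "i \<in> cur n" using False by (auto simp: cur_Suc)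
        then have "j \<noteq> Max (cur n)"
          using Max_ge[OF finite_cur, of i n] cur_less[OF j] by (meson leD)
        then show ?thesis using step False by (simp add: cur_Suc)
      qed (use step in \<open>simp add: cur_Suc\<close>)
    qed (use j in simp)
  next
    case False
    then show ?thesis
      using cur_backwards[OF j] that by simp
  qed
  then show "j \<in> {j \<in> persistent. j < i}"
    using cur_less[OF j] by (simp add: persistent_def)
next
  fix j assume "j \<in> {j \<in> persistent. j < i}"
  then show "j \<in> cur i" by (simp add: persistent_def)
qed

text \<open>Otherwise all persistent items are settled from some time \<open>T\<close> on. At a time
  \<open>n \<ge> T\<close> of minimal stack size, the stack is persistent and calm, so item
  \<open>n\<close> is inserted. It could be deleted only when it is on top again, but then the stack
  is calm because nothing below has moved. So \<open>n\<close> is persistent, yet too young.\<close>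

lemma infinite_persistent: "infinite persistent"
proof
  assume fin: "finite persistent"
  have "\<exists>T. \<forall>j\<in>persistent. \<forall>n\<ge>T. packing n j = packing T j \<and> j < T"
  proof -
    have "\<forall>j\<in>persistent. \<exists>T. \<forall>n\<ge>T. packing n j = packing T j"
      using eventually_fixed by metis
    then obtain \<tau> where \<tau>: "\<And>j n. j \<in> persistent \<Longrightarrow> n \<ge> \<tau> j \<Longrightarrow> packing n j = packing (\<tau> j) j"
      by metis
    \<comment> \<open>The sum exceeds both the settling time and the identifier of every persistent
      item.\<close>
    define T where "T = (\<Sum>j\<in>persistent. \<tau> j + Suc j)"
    have "\<tau> j + Suc j \<le> T" if "j \<in> persistent" for j
      unfolding T_def using fin that by (intro member_le_sum) auto
    then show ?thesis
      using \<tau> by (intro exI[of _ T]) (metis Suc_le_lessD add_leE order_trans order_refl)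
  qed
  then obtain T where fixed: "\<And>j n. j \<in> persistent \<Longrightarrow> n \<ge> T \<Longrightarrow> packing n j = packing T j"
    and old: "\<And>j. j \<in> persistent \<Longrightarrow> j < T"
    by blast
  obtain n where "n \<ge> T" and least: "\<And>m. m \<ge> T \<Longrightarrow> card (cur n) \<le> card (cur m)"
    using ex_has_least_nat[of "\<lambda>n. n \<ge> T" T "\<lambda>n. card (cur n)"] by auto
  have stays: "cur n \<subseteq> cur m" if "m \<ge> n" for m
    by (rule cur_subset_if_card_ge) (use that least \<open>n \<ge> T\<close> in auto)
  have "cur n \<subseteq> persistent"
  proof
    fix i assume i: "i \<in> cur n"
    have "i \<in> cur m" if "m > i" for m
      using stays[of m] cur_backwards[OF i that] i by (cases "m \<ge> n") auto
    then show "i \<in> persistent" by (simp add: persistent_def)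
  qed
  have "calm n"
  proof (rule ccontr)
    assume "\<not> calm n"
    then have "card (cur (Suc n)) < card (cur n)"
      using Max_cur[of n] by (metis cur_Suc card_Diff1_less finite_cur)
    then show False
      using least[of "Suc n"] \<open>n \<ge> T\<close> by simp
  qed
  have "cur n \<union> {n} \<subseteq> cur m" if "m \<ge> Suc n" for m
    using that
  proof (induction m rule: dec_induct)
    case base
    then show ?case using \<open>calm n\<close> by (simp add: cur_Suc)
  next
    case (step m)
    show ?case
    proof (cases "calm m")
      case True
      then show ?thesis using step by (auto simp: cur_Suc)
    next
      case False
      have "Max (cur m) \<noteq> n"
      proof
        assume M: "Max (cur m) = n"
        then have "i \<in> cur n \<or> i = n" if "i \<in> cur m" for i
          using cur_backwards[OF that, of n] Max_ge[OF finite_cur that] step.hyps by force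
        then have cm: "cur m = insert n (cur n)"
          using step.IH by auto
        have same: "packing m j = packing n j" if "j \<in> cur n" for j
          using fixed[of j m] fixed[of j n] that \<open>cur n \<subseteq> persistent\<close> step.hyps \<open>n \<ge> T\<close> by auto
        \<comment> \<open>For \<open>i = n\<close> the reference packing is \<open>packing n\<close>
          itself; for older \<open>i\<close> it agrees with \<open>packing n\<close> by calmness at
          time \<open>n\<close>. The settled items keep these bins until time
          \<open>m\<close>.\<close>
        have "packing i j = packing m j" if "i \<in> cur m" "j \<in> cur m" "j < i" for i j
        proof -
          have "j \<in> cur n"
            using that cur_less unfolding cm by force
          then show ?thesis
            using that \<open>calm n\<close> same unfolding cm calm_def by auto
        qed
        then show False
          using False by (simp add: calm_def)
      qed
      moreover have "Max (cur m) \<ge> n"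
        using step.IH Max_ge[OF finite_cur] by auto
      ultimately have "Max (cur m) \<notin> cur n \<union> {n}"
        using cur_less by fastforce
      then show ?thesis using step.IH False by (auto simp: cur_Suc)
    qed
  qed
  then have "n \<in> persistent" by (auto simp: persistent_def)
  then show False using old \<open>n \<ge> T\<close> by fastforce
qed

section \<open>Transfer of the online lower bound\<close>

text \<open>With the persistent items listed as \<open>e 0 < e 1 < ...\<close>, the dynamic state at
  time \<open>e k\<close> is the online state after \<open>k\<close> items, so bin count and optimum
  agree there.\<close>

lemma ratio_at_least:
  assumes lb: "shows_lower_bound B c" and "a < c"
  shows "\<exists>n. real (fd_num_bins A (upds n)) > a * real (fd_opt (upds n)) + d"
proof -
  define e where "e = enumerate persistent"
  have e_mono: "strict_mono e"
    unfolding e_def using infinite_persistent by (rule strict_mono_enumerate)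
  have e_range: "range e = persistent"
    unfolding e_def using infinite_persistent by (rule range_enumerate)
  have e_inj: "inj_on e K" for K
    using e_mono strict_mono_imp_inj_on inj_on_subset by blast
  have cur_e: "cur (e k) = e ` {..<k}" for k
  proof -
    have "cur (e k) = {j \<in> range e. j < e k}"
      unfolding e_range using e_range by (intro cur_persistent) auto
    then show ?thesis
      using strict_mono_less[OF e_mono] by auto
  qed
  have "\<exists>v. \<exists>T. \<forall>n\<ge>T. packing n (e l) = v" for l
    using eventually_fixed[of "e l"] e_range by (metis rangeI)
  then obtain b where "\<And>l. \<exists>T. \<forall>n\<ge>T. packing n (e l) = b l"
    by metis
  then obtain \<tau> where \<tau>: "\<And>l n. n \<ge> \<tau> l \<Longrightarrow> packing n (e l) = b l"
    by metis
  have packing_e: "packing (e k) (e l) = b l" if "l < k" for k l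
  proof -
    \<comment> \<open>Since \<open>e m \<ge> m\<close>, item \<open>e l\<close> is settled at time
      \<open>e m\<close>, and \<open>e k\<close> is on the stack by then. Calmness at that time says
      that \<open>e l\<close> already lay in its final bin when \<open>e k\<close> was
      sized.\<close>
    define m where "m = Suc k + \<tau> l"
    have "calm (e m)"
      using persistent_calm e_range by blast
    moreover have "e k \<in> cur (e m)" "e l \<in> cur (e m)" "e l < e k"
      using that e_mono by (auto simp: cur_e m_def strict_mono_less)
    ultimately have "packing (e k) (e l) = packing (e m) (e l)"
      by (simp add: calm_def)
    also have "\<dots> = b l"
      using strict_mono_imp_increasing[OF e_mono, of m] by (intro \<tau>) (simp add: m_def)
    finally show ?thesis .
  qed
  define x where "x = next_size \<circ> e"
  have sz_e: "sz (upds (e k)) (e l) = x l" if "l < k" for k l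
    using that by (simp add: x_def sz_upds cur_e)
  have fits: "(\<Sum>l\<in>{l \<in> {..<k}. b l = v}. x l) \<le> 1" for k v
  proof -
    have "{i \<in> cur (e k). packing (e k) i = v} = e ` {l \<in> {..<k}. b l = v}"
      by (auto simp: cur_e packing_e)
    then have "(\<Sum>i\<in>{i \<in> cur (e k). packing (e k) i = v}. sz (upds (e k)) i)
        = (\<Sum>l\<in>{l \<in> {..<k}. b l = v}. x l)"
      by (simp add: sum.reindex[OF e_inj] sz_e)
    then show ?thesis
      using valid wf_upds_upds[of "e k"] unfolding valid_fd_def by metis
  qed
  have state: "packing_state (sz (upds (e k))) (packing (e k)) (cur (e k)) = packing_state x b {..<k}" for k
    unfolding cur_e packing_state_image[OF e_inj]
    by (rule packing_state_cong) (auto simp: sz_e packing_e)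
  \<comment> \<open>Item \<open>e k\<close> was sized from the packing at time \<open>e k\<close>,
    which by \<open>state\<close> is what \<open>B\<close> sees online after \<open>k\<close>
    items.\<close>
  have follows: "x k = s" if "B (packing_state x b {..<k}) = Some s" for k s
    using that by (simp add: x_def next_size_def state)
  obtain k where k: "real (card (b ` {..<k})) > a * real (opt_bins (image_mset x (mset_set {..<k}))) + d"
    using shows_lower_bound_on_run[OF lb fits follows \<open>a < c\<close>] by blast
  have "packing (e k) ` cur (e k) = b ` {..<k}"
    by (auto simp: cur_e packing_e image_iff)
  then have "fd_num_bins A (upds (e k)) = card (b ` {..<k})"
    by (simp add: fd_num_bins_def)
  moreover have "image_mset (sz (upds (e k))) (mset_set (cur (e k))) = image_mset x (mset_set {..<k})"
  proof -
    have "image_mset (sz (upds (e k))) (mset_set (cur (e k)))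
        = image_mset (sz (upds (e k)) \<circ> e) (mset_set {..<k})"
      by (simp add: cur_e image_mset_mset_set[OF e_inj, symmetric] image_mset.compositionality)
    also have "\<dots> = image_mset x (mset_set {..<k})"
      by (rule image_mset_cong) (simp add: sz_e)
    finally show ?thesis .
  qed
  ultimately show ?thesis
    using k unfolding fd_opt_def by metis
qed

end

theorem theorem3p1:
  fixes B :: adversary and c \<beta> :: real
  assumes "\<beta> \<ge> 2"
    and "adversary_process B"
    and "shows_lower_bound B c"
  shows "\<exists>F :: fd_adversary. \<forall>A :: fd_alg.
           valid_fd A \<and> amortized_recourse_le A \<beta> \<longrightarrow>
           (\<forall>n. wf_upds (fd_play F A n)) \<and>
           (\<forall>a < c. \<forall>d. \<exists>n. real (fd_num_bins A (fd_play F A n))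
                             > a * real (fd_opt (fd_play F A n)) + d)"
\<comment> \<open>The instance is built from \<open>B\<close> alone and reacts to \<open>A\<close>
  only through the packings it is shown.\<close>
proof (intro exI[of _ "stack_adversary B"] allI impI)
  fix A assume "valid_fd A \<and> amortized_recourse_le A \<beta>"
  then interpret stack_game B A \<beta>
    using assms(2) by unfold_locales auto
  show "(\<forall>n. wf_upds (fd_play (stack_adversary B) A n)) \<and>
      (\<forall>a < c. \<forall>d. \<exists>n. real (fd_num_bins A (fd_play (stack_adversary B) A n))
         > a * real (fd_opt (fd_play (stack_adversary B) A n)) + d)"
    using wf_upds_upds ratio_at_least[OF assms(3)] unfolding upds_def by blast
qed

end
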